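(* Let $O$ be a unique sink orientation of $Q_n$ and let $f$ be a face of $Q_n$. Then $f$ is a hypervertex of $O$ if and only if for all dimensions $i\in \dim(f)$, all $i$-edges $e$ contained in $f$ and all $i$-edges $e'$ of $Q_n\setminus f$ (i.e. $i$-edges not in $f$), the edges $e$ and $e'$ are not in phase.
   Context: The $n$-cube $Q_n$ is the graph on $\{0,1\}^n$ where two vertices are adjacent iff they differ in exactly one coordinate; an edge whose endpoints differ in coordinate $i$ is an $i$-edge, and $E_i$ is the set of $i$-edges. A face of $Q_n$ is given by a string $f\in\{0,1,*\}^n$ and is the induced subgraph on all $v$ with $v_i=f_i$ or $f_i=*$ for every $i$; $\dim(f)=\{i: f_i=*\}$ is the set of dimensions spanned by $f$. An orientation is a function $O:\{0,1\}^n\to\{0,1\}^n$ (outmap) such that $O(v)_i\ne O(v')_i$ whenever $v,v'$ differ exactly in coordinate $i$; $O(v)_i=1$ means the $i$-edge at $v$ is outgoing from $v$, and $O(v)_i=0$ means it is incoming. $O$ is a unique sink orientation (USO) if every face contains exactly one vertex with no outgoing edges inside the face. Phases: let $O$ be a USO. Two $i$-edges $e,e'\in E_i$ are in direct phase if there exist $v\in e$, $w\in e'$ such that $O(v)_j=O(w)_j$ for all $j\neq i$ with $v_j\ne w_j$. Two $i$-edges are in phase if they are linked by a finite sequence of $i$-edges in which consecutive edges are in direct phase. A face $f$ is a hypervertex of $O$ if for all vertices $v,w\in f$ and all $i\in[n]\setminus\dim(f)$ we have $O(v)_i=O(w)_i$. *)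

theory Defs
  imports Main "HOL-Library.FuncSet"
begin

text \<open>
  Coordinates are \<open>1, \<dots>, n\<close>; the bits 0 and 1 are \<open>False\<close> and \<open>True\<close>.  A vector over an alphabet is
  an extensional function on \<open>{1..n}\<close>, so that equality of vectors is plain equality.
\<close>

definition cube :: "nat \<Rightarrow> (nat \<Rightarrow> bool) set" where
  "cube n = {1..n} \<rightarrow>\<^sub>E UNIV"

definition diff_coords :: "nat \<Rightarrow> (nat \<Rightarrow> bool) \<Rightarrow> (nat \<Rightarrow> bool) \<Rightarrow> nat set" where
  "diff_coords n v w = {j \<in> {1..n}. v j \<noteq> w j}"

definition i_edges :: "nat \<Rightarrow> nat \<Rightarrow> (nat \<Rightarrow> bool) set set" where
  "i_edges n i = {{v, w} | v w. v \<in> cube n \<and> w \<in> cube n \<and> diff_coords n v w = {i}}"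

text \<open>
  A face is a string over \<open>{0, 1, *}\<close>, with \<open>None\<close> in the role of \<open>*\<close>.  The subgraph it induces is
  represented by its vertex set: an edge belongs to the face iff it is a subset of that set.
\<close>

definition faces :: "nat \<Rightarrow> (nat \<Rightarrow> bool option) set" where
  "faces n = {1..n} \<rightarrow>\<^sub>E UNIV"

definition face_dims :: "nat \<Rightarrow> (nat \<Rightarrow> bool option) \<Rightarrow> nat set" where
  "face_dims n f = {i \<in> {1..n}. f i = None}"

definition face_verts :: "nat \<Rightarrow> (nat \<Rightarrow> bool option) \<Rightarrow> (nat \<Rightarrow> bool) set" where
  "face_verts n f = {v \<in> cube n. \<forall>i\<in>{1..n}. f i = Some (v i) \<or> f i = None}"

text \<open>\<open>\<omega> v i\<close> holds iff the \<open>i\<close>-edge at \<open>v\<close> is outgoing from \<open>v\<close>.\<close>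

definition orientation :: "nat \<Rightarrow> ((nat \<Rightarrow> bool) \<Rightarrow> nat \<Rightarrow> bool) \<Rightarrow> bool" where
  "orientation n \<omega> \<longleftrightarrow> \<omega> \<in> cube n \<rightarrow> cube n \<and>
     (\<forall>v\<in>cube n. \<forall>w\<in>cube n. \<forall>i\<in>{1..n}. diff_coords n v w = {i} \<longrightarrow> \<omega> v i \<noteq> \<omega> w i)"

definition uso :: "nat \<Rightarrow> ((nat \<Rightarrow> bool) \<Rightarrow> nat \<Rightarrow> bool) \<Rightarrow> bool" where
  "uso n \<omega> \<longleftrightarrow> orientation n \<omega> \<and>
     (\<forall>f\<in>faces n. \<exists>!v. v \<in> face_verts n f \<and> (\<forall>i\<in>face_dims n f. \<not> \<omega> v i))"

definition direct_phase ::
  "nat \<Rightarrow> ((nat \<Rightarrow> bool) \<Rightarrow> nat \<Rightarrow> bool) \<Rightarrow> nat \<Rightarrow> (nat \<Rightarrow> bool) set \<Rightarrow> (nat \<Rightarrow> bool) set \<Rightarrow> bool" where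
  "direct_phase n \<omega> i e e' \<longleftrightarrow> e \<in> i_edges n i \<and> e' \<in> i_edges n i \<and>
     (\<exists>v\<in>e. \<exists>w\<in>e'. \<forall>j\<in>{1..n}. j \<noteq> i \<and> v j \<noteq> w j \<longrightarrow> \<omega> v j = \<omega> w j)"

definition in_phase ::
  "nat \<Rightarrow> ((nat \<Rightarrow> bool) \<Rightarrow> nat \<Rightarrow> bool) \<Rightarrow> nat \<Rightarrow> (nat \<Rightarrow> bool) set \<Rightarrow> (nat \<Rightarrow> bool) set \<Rightarrow> bool" where
  "in_phase n \<omega> i e e' \<longleftrightarrow> e \<in> i_edges n i \<and> e' \<in> i_edges n i \<and> (direct_phase n \<omega> i)\<^sup>*\<^sup>* e e'"

definition hypervertex ::
  "nat \<Rightarrow> ((nat \<Rightarrow> bool) \<Rightarrow> nat \<Rightarrow> bool) \<Rightarrow> (nat \<Rightarrow> bool option) \<Rightarrow> bool" where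
  "hypervertex n \<omega> f \<longleftrightarrow>
     (\<forall>v\<in>face_verts n f. \<forall>w\<in>face_verts n f. \<forall>i\<in>{1..n} - face_dims n f. \<omega> v i = \<omega> w i)"

end

theory Submission
  imports Defs
begin

text \<open>
  Everything rests on the Szabo--Welzl property: in a unique sink orientation, two distinct
  vertices \<open>v\<close>, \<open>w\<close> have different outmaps on some coordinate in which they differ.

  If \<open>f\<close> is a hypervertex and \<open>v \<in> f\<close>, \<open>w \<notin> f\<close> witness a direct phase between two \<open>i\<close>-edges with
  \<open>i \<in> dim f\<close>, then \<open>w\<close> and its projection to \<open>f\<close> violate this property.  Conversely, if \<open>f\<close> is not
  a hypervertex, then two adjacent vertices \<open>v\<close>, \<open>w\<close> of \<open>f\<close> disagree on some \<open>k \<notin> dim f\<close>, and then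
  \<open>w\<close> and the \<open>k\<close>-neighbour of \<open>v\<close> show that the edge \<open>{v, w}\<close> is in direct phase with the edge
  obtained by moving it out of \<open>f\<close> in direction \<open>k\<close>.
\<close>

lemma cube_upd: "v \<in> cube n \<Longrightarrow> i \<in> {1..n} \<Longrightarrow> v(i := b) \<in> cube n"
  by (auto simp: cube_def PiE_def extensional_def)

lemma cube_eqI:
  assumes "v \<in> cube n" "w \<in> cube n" "\<And>i. i \<in> {1..n} \<Longrightarrow> v i = w i"
  shows "v = w"
  using PiE_ext[OF assms(1,2)[unfolded cube_def]] assms(3) by blast

lemma faces_upd: "f \<in> faces n \<Longrightarrow> i \<in> {1..n} \<Longrightarrow> f(i := b) \<in> faces n"
  by (auto simp: faces_def PiE_def extensional_def)

lemma face_dims_upd: "face_dims n (f(i := Some b)) = face_dims n f - {i}"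
  by (auto simp: face_dims_def)

lemma face_verts_upd:
  assumes "i \<in> face_dims n f"
  shows "face_verts n (f(i := Some b)) = {v \<in> face_verts n f. v i = b}"
  using assms by (auto simp: face_verts_def face_dims_def)

text \<open>
  Adding \<open>i\<close> to \<open>S\<close> amounts to reversing all \<open>i\<close>-edges.  Each of the two facets of \<open>g\<close> in direction
  \<open>i\<close> contains one vertex with the required pattern outside \<open>i\<close>; exactly one of these two has its
  \<open>i\<close>-edge incoming, so exactly one has it outgoing.
\<close>

lemma uso_pattern_unique:
  assumes "uso n \<omega>" "finite S" "g \<in> faces n"
  shows "\<exists>!v. v \<in> face_verts n g \<and> (\<forall>i\<in>face_dims n g. \<omega> v i \<longleftrightarrow> i \<in> S)"
  using assms(2,3)
proof (induction S arbitrary: g rule: finite_induct)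
  case empty
  then show ?case using assms(1) by (auto simp: uso_def)
next
  case (insert i S)
  show ?case
  proof (cases "i \<in> face_dims n g")
    case False
    then have "\<And>v. (\<forall>j\<in>face_dims n g. \<omega> v j \<longleftrightarrow> j \<in> insert i S) \<longleftrightarrow>
        (\<forall>j\<in>face_dims n g. \<omega> v j \<longleftrightarrow> j \<in> S)"
      by auto
    then show ?thesis using insert.IH[OF insert.prems] by simp
  next
    case True
    \<comment> \<open>\<open>Q\<close> asks for the pattern away from \<open>i\<close> only, where
      \<open>S\<close> and \<open>insert i S\<close> agree; thus the facets, the pattern
      \<open>S\<close> and the pattern \<open>insert i S\<close> can all be expressed through
      it.\<close>
    define Q where "Q v \<longleftrightarrow> v \<in> face_verts n g \<and> (\<forall>j\<in>face_dims n g - {i}. \<omega> v j \<longleftrightarrow> j \<in> S)" for v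
    have i: "i \<in> {1..n}" using True by (simp add: face_dims_def)
    have half: "\<exists>!v. Q v \<and> v i = b" for b
      using insert.IH[OF faces_upd[OF insert.prems i, of "Some b"]]
      unfolding face_dims_upd face_verts_upd[OF True] Q_def mem_Collect_eq by (simp only: conj_ac)
    have whole: "\<exists>!v. Q v \<and> \<not> \<omega> v i"
    proof -
      have "\<And>v. (v \<in> face_verts n g \<and> (\<forall>j\<in>face_dims n g. \<omega> v j \<longleftrightarrow> j \<in> S)) \<longleftrightarrow> Q v \<and> \<not> \<omega> v i"
        using True insert.hyps(2) unfolding Q_def by blast
      then show ?thesis using insert.IH[OF insert.prems] by simp
    qed
    have "\<And>v. (v \<in> face_verts n g \<and> (\<forall>j\<in>face_dims n g. \<omega> v j \<longleftrightarrow> j \<in> insert i S)) \<longleftrightarrow> Q v \<and> \<omega> v i"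
      using True unfolding Q_def by blast
    moreover have "\<exists>!v. Q v \<and> \<omega> v i"
    proof -
      obtain a b where "\<forall>v. Q v \<and> v i \<longleftrightarrow> v = a" "\<forall>v. Q v \<and> \<not> v i \<longleftrightarrow> v = b"
        using half[of True] half[of False] unfolding ex1_iff_ex_Uniq Uniq_def by simp metis
      then have "a \<noteq> b" "\<forall>v. Q v \<longleftrightarrow> v = a \<or> v = b" by metis+
      then show ?thesis using whole by auto
    qed
    ultimately show ?thesis by simp
  qed
qed

text \<open>Otherwise \<open>v\<close> and \<open>w\<close> would realise the same pattern in the
  smallest face containing both, against the uniqueness of patterns.\<close>

lemma szabo_welzl:
  assumes "uso n \<omega>" "v \<in> cube n" "w \<in> cube n"
    and eq: "\<And>j. j \<in> diff_coords n v w \<Longrightarrow> \<omega> v j = \<omega> w j"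
  shows "v = w"
proof -
  \<comment> \<open>The smallest face containing \<open>v\<close> and \<open>w\<close>: free exactly
    where they differ.\<close>
  define g where "g = (\<lambda>j\<in>{1..n}. if v j = w j then Some (v j) else None)"
  have g: "g \<in> faces n" by (auto simp: faces_def g_def)
  have dims: "face_dims n g = diff_coords n v w"
    by (auto simp: face_dims_def g_def diff_coords_def)
  have verts: "v \<in> face_verts n g" "w \<in> face_verts n g"
    using assms(2,3) by (auto simp: face_verts_def g_def)
  define S where "S = {j \<in> {1..n}. \<omega> v j}"
  have "finite S" by (simp add: S_def)
  let ?P = "\<lambda>u. u \<in> face_verts n g \<and> (\<forall>j\<in>face_dims n g. \<omega> u j \<longleftrightarrow> j \<in> S)"
  have v: "?P v" using verts(1) by (simp add: S_def face_dims_def)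
  moreover have "?P w"
  proof (intro conjI ballI)
    fix j assume j: "j \<in> face_dims n g"
    then have "\<omega> v j = \<omega> w j" by (intro eq) (simp add: dims)
    then show "\<omega> w j \<longleftrightarrow> j \<in> S" using v j by simp
  qed (rule verts(2))
  moreover have "\<exists>\<^sub>\<le>\<^sub>1u. ?P u"
    using uso_pattern_unique[OF assms(1) \<open>finite S\<close> g] by (simp only: ex1_iff_ex_Uniq)
  ultimately show ?thesis by (intro Uniq_D)
qed

text \<open>The endpoints differ only in \<open>i\<close>, which \<open>f\<close> leaves free. Hence
  a single endpoint, such as a phase witness, decides whether the edge lies in
  \<open>f\<close>.\<close>

lemma i_edge_subset_face_iff:
  assumes "e \<in> i_edges n i" "i \<in> face_dims n f" "v \<in> e"
  shows "e \<subseteq> face_verts n f \<longleftrightarrow> v \<in> face_verts n f"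
proof -
  obtain x y where e: "e = {x, y}" "x \<in> cube n" "y \<in> cube n" "diff_coords n x y = {i}"
    using assms(1) unfolding i_edges_def by blast
  have xy: "x j = y j \<or> f j = None" if "j \<in> {1..n}" for j
  proof (cases "j = i")
    case True
    then show ?thesis using assms(2) by (simp add: face_dims_def)
  next
    case False
    then have "j \<notin> diff_coords n x y" using e(4) by simp
    then show ?thesis using that by (simp add: diff_coords_def)
  qed
  have "(f j = Some (x j) \<or> f j = None) \<longleftrightarrow> (f j = Some (y j) \<or> f j = None)"
    if "j \<in> {1..n}" for j
    using xy[OF that] by auto
  then have "x \<in> face_verts n f \<longleftrightarrow> y \<in> face_verts n f"
    using e(2,3) by (simp add: face_verts_def)
  moreover have "v = x \<or> v = y" using assms(3) e(1) by simp
  ultimately show ?thesis unfolding e(1) by (elim disjE) simp_all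
qed

lemma i_edges_subset_cube: "e \<in> i_edges n i \<Longrightarrow> e \<subseteq> cube n"
  by (auto simp: i_edges_def)

lemma i_edges_upd:
  assumes "v \<in> cube n" "i \<in> {1..n}"
  shows "{v, v(i := \<not> v i)} \<in> i_edges n i"
proof -
  have "diff_coords n v (v(i := \<not> v i)) = {i}" using assms(2) by (auto simp: diff_coords_def)
  then show ?thesis using assms(1) cube_upd[OF assms] unfolding i_edges_def by blast
qed

lemma hypervertex_direct_phase:
  assumes uso: "uso n \<omega>" and f: "hypervertex n \<omega> f" and i: "i \<in> face_dims n f"
    and ph: "direct_phase n \<omega> i e e'" and e: "e \<subseteq> face_verts n f"
  shows "e' \<subseteq> face_verts n f"
proof -
  from ph obtain v w where E: "e' \<in> i_edges n i" and vw: "v \<in> e" "w \<in> e'"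
    and eq: "\<And>j. j \<in> {1..n} \<Longrightarrow> j \<noteq> i \<Longrightarrow> v j \<noteq> w j \<Longrightarrow> \<omega> v j = \<omega> w j"
    unfolding direct_phase_def by blast
  have v: "v \<in> face_verts n f" using e vw by blast
  have w: "w \<in> cube n" using i_edges_subset_cube[OF E] vw by blast
  \<comment> \<open>The projection of \<open>w\<close> to \<open>f\<close>: fixed coordinates come
    from \<open>v\<close>, free ones from \<open>w\<close>. So \<open>p\<close> and \<open>w\<close>
    can differ only where \<open>f\<close> is fixed, in particular not at \<open>i\<close>.\<close>
  define p where "p = (\<lambda>j\<in>{1..n}. if f j = None then w j else v j)"
  have pc: "p \<in> cube n" by (auto simp: p_def cube_def)
  have p: "p \<in> face_verts n f"
    using v pc by (auto simp: face_verts_def p_def)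
  have "p = w"
  proof (rule szabo_welzl[OF uso pc w])
    fix j assume "j \<in> diff_coords n p w"
    then have j: "j \<in> {1..n}" "f j \<noteq> None" "v j \<noteq> w j"
      by (auto simp: diff_coords_def p_def split: if_splits)
    have "j \<noteq> i" using j(2) i by (auto simp: face_dims_def)
    then have "\<omega> v j = \<omega> w j" using j(1,3) by (intro eq)
    moreover have "\<omega> p j = \<omega> v j"
      using f[unfolded hypervertex_def, rule_format, OF p v] j(1,2) by (simp add: face_dims_def)
    ultimately show "\<omega> p j = \<omega> w j" by simp
  qed
  with p show ?thesis using i_edge_subset_face_iff[OF E i vw(2)] by simp
qed

text \<open>The witnesses are opposite corners of a square in directions \<open>i\<close> and
  \<open>k\<close>. Their outmaps agree at \<open>k\<close> because the bit flips twice: once along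
  the \<open>k\<close>-edge, once by \<open>neq\<close>.\<close>

lemma direct_phase_translate:
  assumes or: "orientation n \<omega>" and v: "v \<in> cube n" and i: "i \<in> {1..n}" and k: "k \<in> {1..n}"
    and ik: "i \<noteq> k" and w: "w = v(i := \<not> v i)" and neq: "\<omega> v k \<noteq> \<omega> w k"
  shows "direct_phase n \<omega> i {v, w} {v(k := \<not> v k), w(k := \<not> w k)}"
proof -
  let ?u = "v(k := \<not> v k)"
  have u: "?u \<in> cube n" using cube_upd[OF v k] .
  have "diff_coords n v ?u = {k}" using k by (auto simp: diff_coords_def)
  then have uk: "\<omega> ?u k \<noteq> \<omega> v k" using or v u k unfolding orientation_def by metis
  have "w(k := \<not> w k) = ?u(i := \<not> ?u i)" using ik unfolding w by (simp add: fun_upd_twist)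
  then have "{?u, w(k := \<not> w k)} \<in> i_edges n i" using i_edges_upd[OF u i] by simp
  moreover have "{v, w} \<in> i_edges n i" using i_edges_upd[OF v i] w by simp
  moreover have "\<forall>j\<in>{1..n}. j \<noteq> i \<and> w j \<noteq> ?u j \<longrightarrow> \<omega> w j = \<omega> ?u j"
    using uk neq w by (auto split: if_splits)
  ultimately show ?thesis unfolding direct_phase_def by blast
qed

text \<open>Two vertices of \<open>f\<close> differ only in free coordinates, so changing these one
  at a time gives a path that stays inside \<open>f\<close>; the induction is on Hamming
  distance.\<close>

lemma hypervertexI_adjacent:
  assumes adj: "\<And>v i k. \<lbrakk>v \<in> face_verts n f; i \<in> face_dims n f; k \<in> {1..n} - face_dims n f\<rbrakk> \<Longrightarrow>
      \<omega> v k = \<omega> (v(i := \<not> v i)) k"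
  shows "hypervertex n \<omega> f"
proof -
  have "\<omega> v k = \<omega> w k"
    if "v \<in> face_verts n f" "w \<in> face_verts n f" and k: "k \<in> {1..n} - face_dims n f" for v w k
    using that(1,2)
  proof (induction "card (diff_coords n v w)" arbitrary: v)
    case 0
    then have "diff_coords n v w = {}" by (simp add: diff_coords_def)
    then have "v = w"
      using "0.prems" by (intro cube_eqI[of v n w]) (auto simp: diff_coords_def face_verts_def)
    then show ?case by simp
  next
    case (Suc d)
    from Suc.hyps(2) obtain i where i: "i \<in> diff_coords n v w" by force
    let ?v = "v(i := \<not> v i)"
    have i': "i \<in> {1..n}" "v i \<noteq> w i" using i by (auto simp: diff_coords_def)
    then have idim: "i \<in> face_dims n f"
      using Suc.prems by (force simp: face_dims_def face_verts_def)
    have "?v \<in> face_verts n f"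
      using Suc.prems(1) idim cube_upd[of v n i] by (auto simp: face_verts_def face_dims_def)
    moreover have "diff_coords n ?v w = diff_coords n v w - {i}"
      using i' by (auto simp: diff_coords_def)
    then have "d = card (diff_coords n ?v w)" using Suc.hyps(2) i by simp
    ultimately have "\<omega> ?v k = \<omega> w k" using Suc.hyps(1) Suc.prems(2) by blast
    then show ?case using adj[OF Suc.prems(1) idim k] by simp
  qed
  then show ?thesis unfolding hypervertex_def by (intro ballI)
qed

theorem lemma17:
  fixes n :: nat
    and \<omega> :: "(nat \<Rightarrow> bool) \<Rightarrow> nat \<Rightarrow> bool"
    and f :: "nat \<Rightarrow> bool option"
  assumes "uso n \<omega>"
    and "f \<in> faces n"
  shows "hypervertex n \<omega> f \<longleftrightarrow>
    (\<forall>i\<in>face_dims n f. \<forall>e\<in>i_edges n i. \<forall>e'\<in>i_edges n i.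
       e \<subseteq> face_verts n f \<and> \<not> e' \<subseteq> face_verts n f \<longrightarrow> \<not> in_phase n \<omega> i e e')"
    (is "_ \<longleftrightarrow> ?R")
proof
  assume f: "hypervertex n \<omega> f"
  have "e' \<subseteq> face_verts n f"
    if "i \<in> face_dims n f" "e \<subseteq> face_verts n f" "(direct_phase n \<omega> i)\<^sup>*\<^sup>* e e'" for i e e'
    \<comment> \<open>Induction along the phase sequence: no direct phase leads out of
      \<open>f\<close>.\<close>
    using that(3,2) by induction (use hypervertex_direct_phase[OF assms(1) f that(1)] in blast)+
  then show ?R by (auto simp: in_phase_def)
next
  assume R: ?R
  show "hypervertex n \<omega> f"
  proof (rule hypervertexI_adjacent, rule ccontr)
    fix v :: "nat \<Rightarrow> bool" and i k :: nat
    let ?w = "v(i := \<not> v i)"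
    let ?e = "{v, ?w}" and ?e' = "{v(k := \<not> v k), ?w(k := \<not> ?w k)}"
    assume v: "v \<in> face_verts n f" and i: "i \<in> face_dims n f"
      and k: "k \<in> {1..n} - face_dims n f" and neq: "\<omega> v k \<noteq> \<omega> ?w k"
    have or: "orientation n \<omega>" and vc: "v \<in> cube n" and "i \<in> {1..n}" "k \<in> {1..n}" "i \<noteq> k"
      using assms(1) v i k by (auto simp: uso_def face_verts_def face_dims_def)
    then have ph: "direct_phase n \<omega> i ?e ?e'"
      using neq by (intro direct_phase_translate) auto
    then have E: "?e \<in> i_edges n i" "?e' \<in> i_edges n i" by (auto simp: direct_phase_def)
    have "?e \<subseteq> face_verts n f" using i_edge_subset_face_iff[OF E(1) i, of v] v by blast
    \<comment> \<open>\<open>f\<close> fixes coordinate \<open>k\<close>, so flipping it leaves the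
      face.\<close>
    moreover have "v(k := \<not> v k) \<notin> face_verts n f"
    proof
      assume "v(k := \<not> v k) \<in> face_verts n f"
      then have "f k = Some (\<not> v k) \<or> f k = None" using k by (force simp: face_verts_def)
      moreover have "f k = Some (v k)" using v k by (auto simp: face_verts_def face_dims_def)
      ultimately show False by simp
    qed
    then have "\<not> ?e' \<subseteq> face_verts n f" by blast
    ultimately have "\<not> in_phase n \<omega> i ?e ?e'" using R[rule_format, OF i E] by blast
    then show False using ph E unfolding in_phase_def by blast
  qed
qed

end
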